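(* Let $\gamma^{\rm mW},\gamma^{\rm FSO},\gamma^{\rm THz}$ be independent real random variables with CDFs $F_\gamma^{\rm mW},F_\gamma^{\rm FSO},F_\gamma^{\rm THz}$, and let $\gamma^{\rm OSC}=\max\{\gamma^{\rm mW},\gamma^{\rm THz},\gamma^{\rm FSO}\}$. Then the CDF of $\gamma^{\rm OSC}$ is $$F_\gamma^{\rm OSC}(\gamma)=F_\gamma^{\rm mW}(\gamma)\,F_\gamma^{\rm FSO}(\gamma)\,F_\gamma^{\rm THz}(\gamma).$$
   Context: The random variables $\gamma^{\rm mW},\gamma^{\rm FSO},\gamma^{\rm THz}$ are the SNRs of the mmWave, free-space-optical and terahertz links of a triple-technology backhaul; $\gamma^{\rm OSC}$ is the SNR obtained by opportunistic selection combining, in which the link of maximum SNR is selected. *)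

theory Defs
  imports "HOL-Probability.Probability"
begin

datatype link = mW | FSO | THz

definition SNR_OSC :: "(link \<Rightarrow> 'a \<Rightarrow> real) \<Rightarrow> 'a \<Rightarrow> real" where
  "SNR_OSC \<gamma> \<omega> = Max {\<gamma> mW \<omega>, \<gamma> THz \<omega>, \<gamma> FSO \<omega>}"

(* The library's cdf takes a measure on the reals, so the CDF of a random variable
   is the cdf of its law: CDF M X x is the probability that X \<le> x. *)
definition CDF :: "'a measure \<Rightarrow> ('a \<Rightarrow> real) \<Rightarrow> real \<Rightarrow> real" where
  "CDF M X = cdf (distr M borel X)"

end

theory Submission
  imports Defs
begin

text \<open>A maximum is at most x exactly when each of its entries is
  (\<open>SNR_OSC_le_iff\<close>), so the event that the selected SNR is at most x is the
  intersection of the three events for the single links. Independence turns the probability of this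
  intersection into a product, and \<open>CDF_eq_measure\<close> translates between CDF values and
  probabilities of events.\<close>

lemma UNIV_link: "(UNIV :: link set) = {mW, FSO, THz}"
  by (auto intro: link.exhaust)

lemma CDF_eq_measure:
  assumes "X \<in> borel_measurable M"
  shows "CDF M X x = measure M (X -` {..x} \<inter> space M)"
  using assms by (simp add: CDF_def cdf_def measure_distr)

lemma SNR_OSC_le_iff: "SNR_OSC \<gamma> \<omega> \<le> x \<longleftrightarrow> (\<forall>l. \<gamma> l \<omega> \<le> x)"
proof -
  have "(\<forall>l. \<gamma> l \<omega> \<le> x) \<longleftrightarrow> (\<forall>l\<in>{mW, FSO, THz}. \<gamma> l \<omega> \<le> x)"
    by (simp flip: UNIV_link)
  then show ?thesis
    by (auto simp: SNR_OSC_def)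
qed

text \<open>Needed so that \<open>CDF_eq_measure\<close> applies to the combined SNR. Unfolding
  \<open>Max\<close> into nested binary \<open>max\<close> reduces the claim to closure of
  measurable functions under \<open>max\<close>.\<close>

lemma borel_measurable_SNR_OSC:
  assumes "\<And>l. \<gamma> l \<in> borel_measurable M"
  shows "SNR_OSC \<gamma> \<in> borel_measurable M"
proof -
  have "SNR_OSC \<gamma> = (\<lambda>\<omega>. max (\<gamma> mW \<omega>) (max (\<gamma> THz \<omega>) (\<gamma> FSO \<omega>)))"
    by (simp add: fun_eq_iff SNR_OSC_def)
  then show ?thesis
    using assms by simp
qed

theorem proposition1:
  fixes M :: "'a measure"
    and \<gamma> :: "link \<Rightarrow> 'a \<Rightarrow> real"
    and x :: real
  assumes "prob_space M"
    and "prob_space.indep_vars M (\<lambda>_. borel) \<gamma> UNIV"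
  shows "CDF M (SNR_OSC \<gamma>) x = CDF M (\<gamma> mW) x * CDF M (\<gamma> FSO) x * CDF M (\<gamma> THz) x"
proof -
  interpret prob_space M by fact
  have meas: "\<gamma> l \<in> borel_measurable M" for l
    using assms(2) by (auto simp: indep_vars_def)
  have "CDF M (SNR_OSC \<gamma>) x = prob (SNR_OSC \<gamma> -` {..x} \<inter> space M)"
    by (intro CDF_eq_measure borel_measurable_SNR_OSC meas)
  also have "SNR_OSC \<gamma> -` {..x} \<inter> space M = (\<Inter>l. \<gamma> l -` {..x} \<inter> space M)"
    by (auto simp: SNR_OSC_le_iff)
  \<comment> \<open>Independence is applied to the whole index set, finite by
    \<open>UNIV_link\<close>, with the same Borel set \<open>{..x}\<close> for every link.\<close>
  also have "prob \<dots> = (\<Prod>l\<in>UNIV. prob (\<gamma> l -` {..x} \<inter> space M))"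
    by (rule indep_varsD[OF assms(2)]) (auto simp: UNIV_link)
  also have "\<dots> = CDF M (\<gamma> mW) x * CDF M (\<gamma> FSO) x * CDF M (\<gamma> THz) x"
    by (simp add: UNIV_link CDF_eq_measure[OF meas] mult.assoc)
  finally show ?thesis .
qed

end
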